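(* Let $(X,d)$ be a Polish metric space, $p\ge 1$, and, for $0\le n\le\infty$, let $\Omega_{p,n}(X)=\Omega_n(X)\cap W_p(X)$. The following statements hold: (i) $\theta_p\colon W_p(X)\times W_p(X)\to\mathbb{R}$ is a metric; (ii) for each $0\le n\le\infty$, the restriction of $\theta_{p,n}$ to $\Omega_{p,n}(X)$ defines a metric $\theta_{p,n}\colon\Omega_{p,n}(X)\times\Omega_{p,n}(X)\to\mathbb{R}$; (iii) if $0\le m\le n\le\infty$, then $$\theta_{p,m}(\mu,\nu)\le\theta_{p,n}(\mu,\nu)\le\theta_p(\mu,\nu)\le w_p(\mu,\nu)$$ for any $\mu,\nu\in W_p(X)$.
   Context: $P(X)$ denotes the set of Borel probability measures on $X$; $W_p(X)\subseteq P(X)$ is the set of those with finite $p$-moment, i.e. $\int_X d^p(x,x_0)\,d\mu(x)<\infty$ for some (equivalently all) $x_0\in X$; $w_p$ is the Wasserstein $p$-distance, $w_p(\mu,\nu)=\inf_h\big(\int_{X\times X} d^p(x,y)\,dh(x,y)\big)^{1/p}$ over couplings $h$ of $\mu$ and $\nu$ (the same notation is used on $\mathbb{R}$). $\Lambda(X)$ is the set of all 1-Lipschitz functions $f\colon X\to\mathbb{R}$, and $f_\sharp\mu(U)=\mu(f^{-1}(U))$; pushforwards of elements of $W_p(X)$ under elements of $\Lambda(X)$ lie in $W_p(\mathbb{R})$. For $a\in X$ let $f_a(x)=d(x,a)$. Let $f\wedge g$ denote the pointwise minimum and $I=[0,1]$. For $0\le n<\infty$, $\Lambda_n(X)=\{\alpha_0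 f_{a_0}\wedge\cdots\wedge\alpha_n f_{a_n} : \alpha_i\in I,\ a_i\in X\}\subseteq\Lambda(X)$ (points not necessarily distinct), and $\Lambda_\infty(X)=\bigcup_n\Lambda_n(X)$. For $\mu,\nu\in W_p(X)$ define $$\theta_p(\mu,\nu)=\sup_{f\in\Lambda(X)}w_p(f_\sharp\mu,f_\sharp\nu),\qquad \theta_{p,n}(\mu,\nu)=\sup_{f\in\Lambda_n(X)}w_p(f_\sharp\mu,f_\sharp\nu)\quad(0\le n\le\infty).$$ A closed subset $S\subseteq X$ has covering dimension by balls $\le n$ if any cover of $S$ by open sets in $X$ can be refined to a cover of $S$ by open balls of $X$ such that no sub-collection of $k$ distinct balls in the refinement has non-empty intersection if $k>n+1$. The metric covering dimension $\xi_X(S)$ is the infimum of the integers $n\ge0$ such that $S$ has covering dimension by balls $\le n$ (and $\infty$ if none exists). For $0\le n<\infty$, $\Omega_n(X)=\{\mu\in P(X):\xi_X(\operatorname{supp}\mu)\le n\}$, and $\Omega_\infty(X)=P(X)$. *)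

theory Defs
  imports "HOL-Probability.Probability" "HOL-Library.Extended_Nat"
begin

section \<open>Borel probability measures and Wasserstein distance\<close>

definition borel_probs :: "'a::metric_space measure set" where
  "borel_probs = {\<mu>. prob_space \<mu> \<and> sets \<mu> = sets borel}"

definition wass_space :: "real \<Rightarrow> 'a::metric_space measure set" where
  "wass_space p = {\<mu> \<in> borel_probs. \<exists>x0. (\<integral>\<^sup>+ x. ennreal (dist x x0 powr p) \<partial>\<mu>) < \<infinity>}"

definition couplings :: "'a::metric_space measure \<Rightarrow> 'a measure \<Rightarrow> ('a \<times> 'a) measure set" where
  "couplings \<mu> \<nu> =
    {h \<in> borel_probs. distr h borel fst = \<mu> \<and> distr h borel snd = \<nu>}"

text \<open>Real powers, with positive exponent, of extended nonnegative reals.\<close>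

definition ennreal_powr :: "ennreal \<Rightarrow> real \<Rightarrow> ennreal" where
  "ennreal_powr t a = (if t = \<infinity> then \<infinity> else ennreal (enn2real t powr a))"

text \<open>The distances below take values in \<^typ>\<open>ennreal\<close>, so that no infimum or supremum is
  taken over an empty or unbounded set of reals.\<close>

definition wass_dist ::
  "real \<Rightarrow> 'a::metric_space measure \<Rightarrow> 'a measure \<Rightarrow> ennreal" where
  "wass_dist p \<mu> \<nu> =
    (INF h \<in> couplings \<mu> \<nu>.
      ennreal_powr (\<integral>\<^sup>+ z. ennreal (dist (fst z) (snd z) powr p) \<partial>h) (1 / p))"

section \<open>Classes of 1-Lipschitz functions and the induced distances\<close>

definition Lip1 :: "('a::metric_space \<Rightarrow> real) set" where
  "Lip1 = {f. 1-lipschitz_on UNIV f}"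

definition min_dist_fin :: "nat \<Rightarrow> ('a::metric_space \<Rightarrow> real) set" where
  "min_dist_fin n =
    {(\<lambda>x. Min ((\<lambda>i. \<alpha> i * dist x (a i)) ` {..n})) | \<alpha> a. \<forall>i\<le>n. \<alpha> i \<in> {0..1}}"

definition min_dist :: "enat \<Rightarrow> ('a::metric_space \<Rightarrow> real) set" where
  "min_dist n = (case n of enat k \<Rightarrow> min_dist_fin k | \<infinity> \<Rightarrow> (\<Union>k. min_dist_fin k))"

definition theta :: "real \<Rightarrow> 'a::metric_space measure \<Rightarrow> 'a measure \<Rightarrow> ennreal" where
  "theta p \<mu> \<nu> = (SUP f \<in> Lip1. wass_dist p (distr \<mu> borel f) (distr \<nu> borel f))"

definition theta_n ::
  "real \<Rightarrow> enat \<Rightarrow> 'a::metric_space measure \<Rightarrow> 'a measure \<Rightarrow> ennreal" where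
  "theta_n p n \<mu> \<nu> = (SUP f \<in> min_dist n. wass_dist p (distr \<mu> borel f) (distr \<nu> borel f))"

section \<open>Metric covering dimension\<close>

definition msupport :: "'a::metric_space measure \<Rightarrow> 'a set" where
  "msupport \<mu> = {x. \<forall>U. open U \<longrightarrow> x \<in> U \<longrightarrow> 0 < emeasure \<mu> U}"

lemma closed_msupport: "closed (msupport \<mu>)"
proof -
  have "- msupport \<mu> = \<Union>{U. open U \<and> emeasure \<mu> U = 0}"
    by (auto simp: msupport_def)
  then have "open (- msupport \<mu>)"
    by auto
  then show ?thesis
    by (simp add: closed_def)
qed

text \<open>Balls are counted as subsets of the space, and the intersections are taken in the whole
  space rather than in \<open>S\<close>. The notion is only applied to closed \<open>S\<close>, namely to supports.\<close>

definition ball_covering_dim_le :: "'a::metric_space set \<Rightarrow> nat \<Rightarrow> bool" where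
  "ball_covering_dim_le S n \<longleftrightarrow>
    (\<forall>\<U>. (\<forall>U\<in>\<U>. open U) \<and> S \<subseteq> \<Union>\<U> \<longrightarrow>
      (\<exists>\<B>. (\<forall>B\<in>\<B>. \<exists>x r. 0 < r \<and> B = ball x r) \<and> S \<subseteq> \<Union>\<B> \<and>
           (\<forall>B\<in>\<B>. \<exists>U\<in>\<U>. B \<subseteq> U) \<and>
           (\<forall>\<K>\<subseteq>\<B>. finite \<K> \<and> card \<K> > n + 1 \<longrightarrow> \<Inter>\<K> = {})))"

definition metric_covering_dim :: "'a::metric_space set \<Rightarrow> enat" where
  "metric_covering_dim S = (INF n \<in> {n. ball_covering_dim_le S n}. enat n)"

definition Omega :: "enat \<Rightarrow> 'a::metric_space measure set" where
  "Omega n = (case n of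
      enat k \<Rightarrow> {\<mu> \<in> borel_probs. metric_covering_dim (msupport \<mu>) \<le> enat k}
    | \<infinity> \<Rightarrow> borel_probs)"

definition Omega_p :: "real \<Rightarrow> enat \<Rightarrow> 'a::metric_space measure set" where
  "Omega_p p n = Omega n \<inter> wass_space p"

section \<open>Finite-valued metrics\<close>

definition real_metric_on :: "'b set \<Rightarrow> ('b \<Rightarrow> 'b \<Rightarrow> ennreal) \<Rightarrow> bool" where
  "real_metric_on M D \<longleftrightarrow>
    (\<forall>x\<in>M. \<forall>y\<in>M. D x y < \<infinity>) \<and> Metric_space M (\<lambda>x y. enn2real (D x y))"

end

theory Submission
  imports Defs
begin

text \<open>
  For any family of 1-Lipschitz functions, the supremum of the distances
  \<open>wass_dist p (distr \<mu> borel f) (distr \<nu> borel f)\<close> is at most \<open>wass_dist p \<mu> \<nu>\<close>, because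
  couplings can be pushed forward (\<open>wass_dist_lipschitz_le\<close>), and it inherits symmetry, finiteness
  and the triangle inequality from the Wasserstein distance. A larger family gives a larger
  supremum. What remains is the triangle inequality for the Wasserstein distance itself, and
  separation.

  The triangle inequality (\<open>wass_dist_triangle\<close>) is usually obtained by gluing two couplings
  along their common marginal, which requires disintegration. Here the gluing is only
  approximate: the space is cut into countably many cells of diameter less than \<open>e\<close>, and the two
  couplings are joined independently given the cell of the middle point
  (\<open>approximate_gluing\<close>). The resulting error \<open>e\<close> enters Minkowski's inequality
  additively and tends to 0.

  For separation, vanishing distances on the line mean that \<open>\<mu>\<close> and \<open>\<nu>\<close> have the same
  pushforward under every function of the family (\<open>wass_dist_zero_imp_eq\<close>). The sublevel sets of
  minima of \<open>n + 1\<close> scaled distance functions are general enough to include every union of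
  \<open>n + 1\<close> balls, so the measures agree on those unions (\<open>emeasure_UN_balls_eq\<close>). If the support
  of \<open>\<mu>\<close> has covering dimension by balls at most \<open>n\<close>, a closed set can be covered, up to a null
  set and inside a given open neighbourhood, by balls of which at most \<open>n + 1\<close> meet at a point; by
  inclusion-exclusion the measure of their union depends only on the unions of at most \<open>n + 1\<close> of
  them (\<open>emeasure_Union_eq_of_small_unions\<close>). This compares \<open>\<mu>\<close> and \<open>\<nu>\<close> on open sets, and
  by symmetry they are equal (\<open>min_dist_separates_Omega\<close>). If all finite minima are available, the
  measures agree on all finite unions of balls and hence on open sets.
\<close>

section \<open>Couplings and the Wasserstein distance\<close>

abbreviation transport_cost :: "real \<Rightarrow> ('a::metric_space \<times> 'a) measure \<Rightarrow> ennreal" where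
  "transport_cost p h \<equiv> \<integral>\<^sup>+ z. ennreal (dist (fst z) (snd z) powr p) \<partial>h"

text \<open>With this equivalence, bounds on the Wasserstein distance become bounds on the cost of a
  single coupling, and the root and the infinite values disappear from the later arguments.\<close>

lemma ennreal_powr_inverse_le_iff:
  assumes "0 < p" "0 \<le> a"
  shows "ennreal_powr t (1 / p) \<le> ennreal a \<longleftrightarrow> t \<le> ennreal (a powr p)"
proof (cases t rule: ennreal_cases)
  case (real r)
  have "r powr (1 / p) \<le> a \<longleftrightarrow> r \<le> a powr p"
  proof
    assume "r powr (1 / p) \<le> a"
    then have "(r powr (1 / p)) powr p \<le> a powr p"
      using assms by (intro powr_mono2) auto
    then show "r \<le> a powr p"
      using assms real by (simp add: powr_powr)
  next
    assume "r \<le> a powr p"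
    then have "r powr (1 / p) \<le> (a powr p) powr (1 / p)"
      using assms real by (intro powr_mono2) auto
    then show "r powr (1 / p) \<le> a"
      using assms by (simp add: powr_powr)
  qed
  then show ?thesis
    using assms real by (simp add: ennreal_powr_def)
qed (use assms in \<open>simp add: ennreal_powr_def top_unique\<close>)

lemma ennreal_powr_mono:
  assumes "0 \<le> a" "s \<le> t"
  shows "ennreal_powr s a \<le> ennreal_powr t a"
  using assms
  by (cases t rule: ennreal_cases; cases s rule: ennreal_cases)
    (auto simp: ennreal_powr_def top_unique intro!: powr_mono2)

lemma wass_dist_leI:
  assumes "h \<in> couplings \<mu> \<nu>" "transport_cost p h \<le> ennreal (a powr p)" "0 < p" "0 \<le> a"
  shows "wass_dist p \<mu> \<nu> \<le> ennreal a"
  unfolding wass_dist_def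
  using assms by (intro INF_lower2[of h]) (simp_all add: ennreal_powr_inverse_le_iff)

lemma wass_dist_lessE:
  assumes "wass_dist p \<mu> \<nu> < ennreal a" "0 < p"
  obtains h where "h \<in> couplings \<mu> \<nu>" "transport_cost p h \<le> ennreal (a powr p)"
proof -
  have "0 < a"
    using assms(1) by (metis ennreal_neg not_less not_less_zero)
  obtain h where h: "h \<in> couplings \<mu> \<nu>" "ennreal_powr (transport_cost p h) (1 / p) < ennreal a"
    using assms(1) unfolding wass_dist_def INF_less_iff by blast
  then have "transport_cost p h \<le> ennreal (a powr p)"
    using assms(2) \<open>0 < a\<close> by (simp add: less_imp_le flip: ennreal_powr_inverse_le_iff)
  with h(1) show thesis ..
qed

lemma borel_probsD:
  assumes "\<mu> \<in> borel_probs"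
  shows "prob_space \<mu>" "sets \<mu> = sets borel" "space \<mu> = UNIV"
  using assms sets_eq_imp_space_eq[of \<mu> borel] by (auto simp: borel_probs_def)

lemma measurable_from_borel_probs:
  assumes "\<mu> \<in> borel_probs"
  shows "measurable \<mu> N = measurable borel N"
  using borel_probsD[OF assms] by (intro measurable_cong_sets) auto

lemma distr_in_borel_probs:
  assumes "\<mu> \<in> borel_probs" "f \<in> borel_measurable borel"
  shows "distr \<mu> borel f \<in> borel_probs"
  using assms borel_probsD(1)[OF assms(1)]
  by (auto simp: borel_probs_def measurable_from_borel_probs intro!: prob_space.prob_space_distr)

lemma borel_measurable_fst_snd:
  "fst \<in> borel_measurable (borel :: ('a::topological_space \<times> 'b::topological_space) measure)"
  "snd \<in> borel_measurable (borel :: ('a \<times> 'b) measure)"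
  by (auto intro!: borel_measurable_continuous_onI continuous_intros)

lemma couplingsD:
  assumes "h \<in> couplings \<mu> \<nu>"
  shows "h \<in> borel_probs" "distr h borel fst = \<mu>" "distr h borel snd = \<nu>"
    "\<mu> \<in> borel_probs" "\<nu> \<in> borel_probs"
proof -
  show *: "h \<in> borel_probs" "distr h borel fst = \<mu>" "distr h borel snd = \<nu>"
    using assms by (auto simp: couplings_def)
  show "\<mu> \<in> borel_probs" "\<nu> \<in> borel_probs"
    using distr_in_borel_probs[OF *(1) borel_measurable_fst_snd(1)]
      distr_in_borel_probs[OF *(1) borel_measurable_fst_snd(2)] * by auto
qed

lemma distr_in_couplings:
  assumes "\<mu> \<in> borel_probs" "f \<in> borel_measurable borel"
    "fst \<circ> f \<in> borel_measurable borel" "snd \<circ> f \<in> borel_measurable borel"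
  shows "distr \<mu> borel f \<in> couplings (distr \<mu> borel (fst \<circ> f)) (distr \<mu> borel (snd \<circ> f))"
  using assms
  by (auto simp: couplings_def distr_in_borel_probs measurable_from_borel_probs distr_distr
      borel_measurable_fst_snd)

lemma transport_cost_distr:
  fixes f :: "'a::metric_space \<Rightarrow> 'b::metric_space \<times> 'b"
  assumes "\<mu> \<in> borel_probs" "f \<in> borel_measurable borel"
  shows "transport_cost p (distr \<mu> borel f) = (\<integral>\<^sup>+ x. ennreal (dist (fst (f x)) (snd (f x)) powr p) \<partial>\<mu>)"
proof -
  have [measurable]: "(\<lambda>z :: 'b \<times> 'b. dist (fst z) (snd z)) \<in> borel_measurable borel"
    by (intro borel_measurable_continuous_onI continuous_intros)
  have "(\<lambda>z :: 'b \<times> 'b. ennreal (dist (fst z) (snd z) powr p)) \<in> borel_measurable borel"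
    by measurable
  then show ?thesis
    using assms by (subst nn_integral_distr) (simp_all add: measurable_from_borel_probs)
qed

text \<open>The diagonal image of a measure couples it with itself and moves nothing.\<close>

lemma wass_dist_self:
  assumes "\<mu> \<in> borel_probs" "0 < p"
  shows "wass_dist p \<mu> \<mu> = 0"
proof -
  let ?diag = "\<lambda>x::'a. (x, x)"
  have m: "?diag \<in> borel_measurable borel" "(\<lambda>x::'a. x) \<in> borel_measurable borel"
    by (auto intro!: borel_measurable_continuous_onI continuous_intros)
  have "distr \<mu> borel (\<lambda>x. x) = \<mu>"
    using borel_probsD[OF assms(1)] by (intro measure_eqI) (simp_all add: emeasure_distr measurable_from_borel_probs[OF assms(1)])
  with distr_in_couplings[OF assms(1) m(1)] m
  have "distr \<mu> borel ?diag \<in> couplings \<mu> \<mu>"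
    by (simp add: comp_def)
  moreover have "transport_cost p (distr \<mu> borel ?diag) = 0"
    by (simp add: transport_cost_distr[OF assms(1) m(1)])
  ultimately have "wass_dist p \<mu> \<mu> \<le> ennreal 0"
    using assms by (intro wass_dist_leI) auto
  then show ?thesis by simp
qed

text \<open>Exchanging the two coordinates of a coupling preserves its cost.\<close>

lemma wass_dist_commute_le:
  fixes \<mu> \<nu> :: "'a::metric_space measure"
  shows "wass_dist p \<mu> \<nu> \<le> wass_dist p \<nu> \<mu>"
  unfolding wass_dist_def
proof (rule INF_mono)
  fix h assume "h \<in> couplings \<nu> \<mu>"
  note h = couplingsD[OF this]
  have m: "prod.swap \<in> borel_measurable (borel :: ('a \<times> 'a) measure)"
    "fst \<circ> prod.swap = (snd :: 'a \<times> 'a \<Rightarrow> 'a)" "snd \<circ> prod.swap = (fst :: 'a \<times> 'a \<Rightarrow> 'a)"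
    by (auto simp: prod.swap_def intro!: borel_measurable_continuous_onI continuous_intros)
  have "distr h borel prod.swap \<in> couplings \<mu> \<nu>"
    using distr_in_couplings[OF h(1) m(1)] h m by (simp add: borel_measurable_fst_snd)
  moreover have "transport_cost p (distr h borel prod.swap) = transport_cost p h"
    by (simp add: transport_cost_distr[OF h(1) m(1)] dist_commute)
  ultimately show "\<exists>h'\<in>couplings \<mu> \<nu>. ennreal_powr (transport_cost p h') (1 / p) \<le> ennreal_powr (transport_cost p h) (1 / p)"
    by (intro bexI[of _ "distr h borel prod.swap"]) simp_all
qed

lemma wass_dist_commute: "wass_dist p \<mu> \<nu> = wass_dist p \<nu> \<mu>"
  by (intro antisym wass_dist_commute_le)

lemma lipschitz_borel_measurable:
  fixes f :: "'a::metric_space \<Rightarrow> 'b::metric_space"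
  assumes "L-lipschitz_on UNIV f"
  shows "f \<in> borel_measurable borel"
  using assms by (intro borel_measurable_continuous_onI lipschitz_on_continuous_on)

text \<open>A map that does not increase distances, applied to both coordinates of a coupling, does not
  increase its cost.\<close>

lemma wass_dist_lipschitz_le:
  fixes f :: "'a::metric_space \<Rightarrow> 'b::metric_space"
  assumes f: "1-lipschitz_on UNIV f" and p: "0 \<le> p"
  shows "wass_dist p (distr \<mu> borel f) (distr \<nu> borel f) \<le> wass_dist p \<mu> \<nu>"
  unfolding wass_dist_def
proof (rule INF_mono)
  fix h assume "h \<in> couplings \<mu> \<nu>"
  note h = couplingsD[OF this]
  note mf = lipschitz_borel_measurable[OF f]
  have cf: "continuous_on UNIV f"
    using f by (rule lipschitz_on_continuous_on)
  have m: "map_prod f f \<in> borel_measurable borel"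
    unfolding map_prod_def split_beta
    by (intro borel_measurable_continuous_onI continuous_intros continuous_on_compose2[OF cf]) auto
  have eq: "fst \<circ> map_prod f f = f \<circ> fst" "snd \<circ> map_prod f f = f \<circ> snd"
    by auto
  have "distr h borel (f \<circ> fst) = distr \<mu> borel f" "distr h borel (f \<circ> snd) = distr \<nu> borel f"
    using h(2,3) mf by (auto simp: distr_distr measurable_from_borel_probs[OF h(1)] borel_measurable_fst_snd)
  then have "distr h borel (map_prod f f) \<in> couplings (distr \<mu> borel f) (distr \<nu> borel f)"
    using distr_in_couplings[OF h(1) m] mf measurable_comp[OF borel_measurable_fst_snd(1) mf]
      measurable_comp[OF borel_measurable_fst_snd(2) mf] unfolding eq
    by simp
  moreover have "transport_cost p (distr h borel (map_prod f f)) \<le> transport_cost p h"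
    unfolding transport_cost_distr[OF h(1) m]
    using lipschitz_onD[OF f] p by (intro nn_integral_mono ennreal_leI powr_mono2) auto
  ultimately show "\<exists>h'\<in>couplings (distr \<mu> borel f) (distr \<nu> borel f).
      ennreal_powr (transport_cost p h') (1 / p) \<le> ennreal_powr (transport_cost p h) (1 / p)"
    using p by (intro bexI[of _ "distr h borel (map_prod f f)"] ennreal_powr_mono) auto
qed

section \<open>The triangle inequality\<close>

text \<open>Convexity of \<open>t \<mapsto> t powr p\<close>: the point \<open>(x + y) / (A + B)\<close> is the convex combination
  of \<open>x / A\<close> and \<open>y / B\<close> with weights \<open>A / (A + B)\<close> and \<open>B / (A + B)\<close>. When \<open>A\<close> and \<open>B\<close>
  bound two \<open>p\<close>-norms, integrating this estimate yields Minkowski's inequality.\<close>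

lemma powr_sum_le:
  fixes x y A B :: real
  assumes "1 \<le> p" "0 < A" "0 < B" "0 \<le> x" "0 \<le> y"
  shows "((x + y) / (A + B)) powr p \<le> A / (A + B) * (x / A) powr p + B / (A + B) * (y / B) powr p"
proof -
  have conv: "(s * u + (1 - s) * v) powr p \<le> s * u powr p + (1 - s) * v powr p"
    if suv: "0 \<le> s" "s \<le> 1" "0 \<le> u" "0 \<le> v" for s u v :: real
  proof -
    have sp: "s powr p \<le> s" if "0 \<le> s" "s \<le> 1" for s :: real
      using that assms(1) by (cases "s = 0") (auto intro: powr_le_one_le)
    \<comment> \<open>Convexity is available on the open half-line, so the endpoint 0 is checked separately\<close>
    consider "u = 0" | "v = 0" | "0 < u" "0 < v"
      using suv by linarith
    then show ?thesis
    proof cases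
      case 1
      have "(1 - s) powr p * v powr p \<le> (1 - s) * v powr p"
        using suv sp[of "1 - s"] by (intro mult_right_mono) auto
      with 1 show ?thesis
        using suv by (simp add: powr_mult)
    next
      case 2
      have "s powr p * u powr p \<le> s * u powr p"
        using suv sp[of s] by (intro mult_right_mono) auto
      with 2 show ?thesis
        using suv by (simp add: powr_mult)
    next
      case 3
      then show ?thesis
        using convex_onD[OF powr_convex[OF assms(1)], of "1 - s" u v] suv by (simp add: algebra_simps)
    qed
  qed
  have s: "1 - A / (A + B) = B / (A + B)"
    using assms by (simp add: field_simps)
  have "(x + y) / (A + B) = A / (A + B) * (x / A) + (1 - A / (A + B)) * (y / B)"
    unfolding s using assms by (simp add: add_divide_distrib)
  then show ?thesis
    using conv[of "A / (A + B)" "x / A" "y / B"] assms unfolding s by simp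
qed

text \<open>The two \<open>p\<close>-norms are replaced by positive bounds \<open>A\<close> and \<open>B\<close> on them, by which one
  can divide even if a norm vanishes.\<close>

lemma nn_integral_Minkowski:
  fixes f g :: "'a \<Rightarrow> real"
  assumes p: "1 \<le> p" and [measurable]: "f \<in> borel_measurable M" "g \<in> borel_measurable M"
    and nn: "\<And>x. 0 \<le> f x" "\<And>x. 0 \<le> g x" and "0 < A" "0 < B"
    and f: "(\<integral>\<^sup>+ x. ennreal (f x powr p) \<partial>M) \<le> ennreal (A powr p)"
    and g: "(\<integral>\<^sup>+ x. ennreal (g x powr p) \<partial>M) \<le> ennreal (B powr p)"
  shows "(\<integral>\<^sup>+ x. ennreal ((f x + g x) powr p) \<partial>M) \<le> ennreal ((A + B) powr p)"
proof -
  define C a b where "C = (A + B) powr p"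
    and "a = C * (A / (A + B) / A powr p)" and "b = C * (B / (A + B) / B powr p)"
  have nn': "0 \<le> C" "0 \<le> a" "0 \<le> b"
    using assms by (auto simp: C_def a_def b_def)
  have pos: "0 < A powr p" "0 < B powr p" "0 < A + B"
    using assms by auto
  have le: "ennreal ((f x + g x) powr p) \<le> ennreal a * ennreal (f x powr p) + ennreal b * ennreal (g x powr p)" for x
  proof -
    have "(f x + g x) powr p = C * ((f x + g x) / (A + B)) powr p"
      using assms by (simp add: C_def powr_divide)
    also have "\<dots> \<le> C * (A / (A + B) * (f x / A) powr p + B / (A + B) * (g x / B) powr p)"
      using assms nn' by (intro mult_left_mono powr_sum_le) auto
    also have "\<dots> = a * f x powr p + b * g x powr p"
      using assms by (simp add: a_def b_def powr_divide algebra_simps)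
    finally have "ennreal ((f x + g x) powr p) \<le> ennreal (a * f x powr p + b * g x powr p)"
      by (rule ennreal_leI)
    also have "\<dots> = ennreal a * ennreal (f x powr p) + ennreal b * ennreal (g x powr p)"
      using nn' by (simp add: ennreal_plus ennreal_mult)
    finally show ?thesis .
  qed
  have "(\<integral>\<^sup>+ x. ennreal ((f x + g x) powr p) \<partial>M) \<le>
      (\<integral>\<^sup>+ x. ennreal a * ennreal (f x powr p) + ennreal b * ennreal (g x powr p) \<partial>M)"
    by (intro nn_integral_mono le)
  also have "\<dots> = ennreal a * (\<integral>\<^sup>+ x. ennreal (f x powr p) \<partial>M) + ennreal b * (\<integral>\<^sup>+ x. ennreal (g x powr p) \<partial>M)"
    by (subst nn_integral_add) (simp_all add: nn_integral_cmult)
  also have "\<dots> \<le> ennreal a * ennreal (A powr p) + ennreal b * ennreal (B powr p)"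
    by (intro add_mono mult_left_mono f g) auto
  also have "\<dots> = ennreal (a * A powr p + b * B powr p)"
    using nn' by (simp add: ennreal_plus ennreal_mult)
  also have "a * A powr p + b * B powr p = C * (A / (A + B)) + C * (B / (A + B))"
    using pos by (simp add: a_def b_def)
  also have "\<dots> = C * ((A + B) / (A + B))"
    unfolding add_divide_distrib distrib_left ..
  also have "\<dots> = (A + B) powr p"
    using pos by (simp add: C_def)
  finally show ?thesis .
qed

text \<open>A separable space splits into countably many Borel cells of small diameter: each point is
  labelled by the first member of a dense sequence that lies within \<open>e / 2\<close> of it.\<close>

lemma ex_countable_partition_small:
  fixes e :: real
  assumes "0 < e"
  obtains idx :: "'a::{metric_space, second_countable_topology} \<Rightarrow> nat"
  where "idx \<in> measurable borel (count_space UNIV)" "\<And>x y. idx x = idx y \<Longrightarrow> dist x y < e"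
proof -
  obtain D :: "'a set" where D: "countable D" "\<And>X. open X \<Longrightarrow> X \<noteq> {} \<Longrightarrow> \<exists>d\<in>D. d \<in> X"
    using countable_dense_setE by blast
  define q where "q = from_nat_into D"
  have ex: "\<exists>n. dist x (q n) < e / 2" for x
  proof -
    have "ball x (e / 2) \<noteq> {}" using assms by auto
    then obtain d where "d \<in> D" "d \<in> ball x (e / 2)"
      using D(2)[of "ball x (e / 2)"] by blast
    then show ?thesis
      using from_nat_into_surj[OF D(1), of d] by (auto simp: q_def)
  qed
  define idx where "idx x = (LEAST n. dist x (q n) < e / 2)" for x
  have "idx \<in> measurable borel (count_space UNIV)"
    unfolding idx_def by measurable
  moreover have "dist x y < e" if "idx x = idx y" for x y
  proof -
    have "dist x (q (idx x)) < e / 2" "dist y (q (idx y)) < e / 2"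
      unfolding idx_def by (rule LeastI_ex[OF ex])+
    with that show ?thesis
      by (metis dist_triangle_half_l)
  qed
  ultimately show thesis ..
qed

text \<open>The two measures are made conditionally independent given a common label. If \<open>c n\<close> is the
  probability of the label \<open>n\<close>, the glued measure has density \<open>1 / c n\<close> with respect to the
  product where both labels are \<open>n\<close>, and density 0 where the labels differ. Integrating
  out one coordinate gives \<open>c n / c n = 1\<close>, so the marginals are right.\<close>

lemma gluing_along_countable_labels:
  fixes a :: "'a \<Rightarrow> nat" and b :: "'b \<Rightarrow> nat"
  assumes "prob_space h" "prob_space k"
    and a[measurable]: "a \<in> measurable h (count_space UNIV)"
    and b[measurable]: "b \<in> measurable k (count_space UNIV)"
    and labels: "distr h (count_space UNIV) a = distr k (count_space UNIV) b"
  obtains G where "sets G = sets (h \<Otimes>\<^sub>M k)" "distr G h fst = h" "distr G k snd = k"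
    "AE z in G. a (fst z) = b (snd z)"
proof -
  interpret h: prob_space h by fact
  interpret k: prob_space k by fact
  interpret hk: pair_prob_space h k ..
  let ?L = "distr h (count_space UNIV) a"
  interpret L: prob_space ?L
    by (rule h.prob_space_distr) simp
  define c where "c n = emeasure ?L {n}" for n
  have c_fin: "c n \<noteq> \<infinity>" for n
    by (simp add: c_def)
  \<comment> \<open>the density is infinite on labels of probability 0, which form a null set\<close>
  have c_pos: "AE n in ?L. c n \<noteq> 0"
  proof -
    have "AE i in ?L. i \<noteq> n" if "c n = 0" for n
      using that by (intro AE_I[of _ _ "{n}"]) (auto simp: c_def)
    then have "AE i in ?L. \<forall>n. c n = 0 \<longrightarrow> i \<noteq> n"
      by (subst AE_all_countable) auto
    then show ?thesis
      by eventually_elim auto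
  qed
  have slice: "(\<integral>\<^sup>+ i. (if n = i then 1 / c n else 0) \<partial>?L) = 1" if "c n \<noteq> 0" for n
  proof -
    have "(\<integral>\<^sup>+ i. (if n = i then 1 / c n else 0) \<partial>?L) = (\<integral>\<^sup>+ i. 1 / c n * indicator {n} i \<partial>?L)"
      by (intro nn_integral_cong) (auto split: split_indicator)
    also have "\<dots> = 1 / c n * c n"
      by (subst nn_integral_cmult_indicator) (simp_all add: c_def)
    also have "\<dots> = 1"
      using that c_fin[of n] by (simp add: ennreal_divide_times divide_eq_1_ennreal less_top)
    finally show ?thesis .
  qed
  define g where "g z = (if a (fst z) = b (snd z) then 1 / c (a (fst z)) else 0)" for z
  have "(\<lambda>z. if n = b (snd z) then 1 / c n else 0) \<in> borel_measurable (h \<Otimes>\<^sub>M k)" for n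
    by measurable
  then have [measurable]: "g \<in> borel_measurable (h \<Otimes>\<^sub>M k)"
    unfolding g_def by (rule measurable_compose_countable) measurable
  define G where "G = density (h \<Otimes>\<^sub>M k) g"
  have setsG[measurable_cong]: "sets G = sets (h \<Otimes>\<^sub>M k)"
    by (simp add: G_def)
  have G1: "distr G h fst = h"
  proof (rule measure_eqI)
    fix A assume "A \<in> sets (distr G h fst)"
    then have [measurable]: "A \<in> sets h" by simp
    have "emeasure (distr G h fst) A = (\<integral>\<^sup>+ z. indicator A (fst z) \<partial>G)"
      by (subst nn_integral_indicator[symmetric], simp, subst nn_integral_distr) auto
    also have "\<dots> = (\<integral>\<^sup>+ z. g z * indicator A (fst z) \<partial>(h \<Otimes>\<^sub>M k))"
      unfolding G_def by (subst nn_integral_density) auto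
    also have "\<dots> = (\<integral>\<^sup>+ u. \<integral>\<^sup>+ v. g (u, v) * indicator A u \<partial>k \<partial>h)"
      by (subst k.nn_integral_fst[symmetric]) auto
    also have "\<dots> = (\<integral>\<^sup>+ u. indicator A u \<partial>h)"
    proof (rule nn_integral_cong_AE)
      have "AE u in h. c (a u) \<noteq> 0"
        using c_pos by (subst (asm) AE_distr_iff) auto
      then show "AE u in h. (\<integral>\<^sup>+ v. g (u, v) * indicator A u \<partial>k) = indicator A u"
        using AE_space
      proof eventually_elim
        case (elim u)
        have "(\<integral>\<^sup>+ v. g (u, v) * indicator A u \<partial>k) = (\<integral>\<^sup>+ v. g (u, v) \<partial>k) * indicator A u"
          using elim(2) by (subst nn_integral_multc) auto
        also have "(\<integral>\<^sup>+ v. g (u, v) \<partial>k) = (\<integral>\<^sup>+ i. (if a u = i then 1 / c (a u) else 0) \<partial>?L)"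
          unfolding labels by (subst nn_integral_distr) (auto simp: g_def intro!: nn_integral_cong)
        finally show ?case
          using slice[OF elim(1)] by simp
      qed
    qed
    also have "\<dots> = emeasure h A"
      by simp
    finally show "emeasure (distr G h fst) A = emeasure h A" .
  qed simp
  have G2: "distr G k snd = k"
  proof (rule measure_eqI)
    fix A assume "A \<in> sets (distr G k snd)"
    then have [measurable]: "A \<in> sets k" by simp
    have "emeasure (distr G k snd) A = (\<integral>\<^sup>+ z. indicator A (snd z) \<partial>G)"
      by (subst nn_integral_indicator[symmetric], simp, subst nn_integral_distr) auto
    also have "\<dots> = (\<integral>\<^sup>+ z. g z * indicator A (snd z) \<partial>(h \<Otimes>\<^sub>M k))"
      unfolding G_def by (subst nn_integral_density) auto
    also have "\<dots> = (\<integral>\<^sup>+ v. \<integral>\<^sup>+ u. g (u, v) * indicator A v \<partial>h \<partial>k)"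
      by (subst hk.nn_integral_snd[symmetric]) auto
    also have "\<dots> = (\<integral>\<^sup>+ v. indicator A v \<partial>k)"
    proof (rule nn_integral_cong_AE)
      have "AE v in k. c (b v) \<noteq> 0"
        using c_pos unfolding labels by (subst (asm) AE_distr_iff) auto
      then show "AE v in k. (\<integral>\<^sup>+ u. g (u, v) * indicator A v \<partial>h) = indicator A v"
        using AE_space
      proof eventually_elim
        case (elim v)
        have "(\<integral>\<^sup>+ u. g (u, v) * indicator A v \<partial>h) = (\<integral>\<^sup>+ u. g (u, v) \<partial>h) * indicator A v"
          using elim(2) by (subst nn_integral_multc) auto
        also have "(\<integral>\<^sup>+ u. g (u, v) \<partial>h) = (\<integral>\<^sup>+ i. (if b v = i then 1 / c (b v) else 0) \<partial>?L)"
          by (subst nn_integral_distr) (auto simp: g_def intro!: nn_integral_cong)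
        finally show ?case
          using slice[OF elim(1)] by simp
      qed
    qed
    also have "\<dots> = emeasure k A"
      by simp
    finally show "emeasure (distr G k snd) A = emeasure k A" .
  qed simp
  have "AE z in G. a (fst z) = b (snd z)"
    unfolding G_def by (subst AE_density) (auto simp: g_def)
  with setsG G1 G2 show thesis
    by (rule that)
qed

text \<open>The gluing of \<open>h\<close> and \<open>k\<close> over their common marginal \<open>\<nu>\<close>, up to an error \<open>e\<close>. The
  glued measure carries two copies of the middle point, which only have to lie in the same cell
  of a countable partition into sets of diameter less than \<open>e\<close>; so the cells serve as
  the labels of \<open>gluing_along_countable_labels\<close>.\<close>

lemma approximate_gluing:
  fixes \<mu> \<nu> \<rho> :: "'a::{metric_space, second_countable_topology} measure"
  assumes h: "h \<in> couplings \<mu> \<nu>" and k: "k \<in> couplings \<nu> \<rho>" and "0 < e"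
  obtains G where "G \<in> borel_probs" "distr G borel fst = h" "distr G borel snd = k"
    "AE z in G. dist (snd (fst z)) (fst (snd z)) < e"
proof -
  note h = couplingsD[OF h] and k = couplingsD[OF k]
  note hp = borel_probsD[OF h(1)] and kp = borel_probsD[OF k(1)]
  obtain idx :: "'a \<Rightarrow> nat" where idx: "idx \<in> measurable borel (count_space UNIV)"
    and small: "\<And>x y. idx x = idx y \<Longrightarrow> dist x y < e"
    using ex_countable_partition_small[OF \<open>0 < e\<close>] by blast
  have m: "snd \<in> borel_measurable h" "fst \<in> borel_measurable k"
    by (simp_all add: measurable_from_borel_probs h k borel_measurable_fst_snd)
  have "distr h (count_space UNIV) (idx \<circ> snd) = distr k (count_space UNIV) (idx \<circ> fst)"
    using h(3) k(2) by (simp flip: distr_distr[OF idx m(1)] distr_distr[OF idx m(2)])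
  then obtain G where G: "sets G = sets (h \<Otimes>\<^sub>M k)" "distr G h fst = h" "distr G k snd = k"
    "AE z in G. (idx \<circ> snd) (fst z) = (idx \<circ> fst) (snd z)"
    using gluing_along_countable_labels[OF hp(1) kp(1) measurable_comp[OF m(1) idx] measurable_comp[OF m(2) idx]]
    by blast
  have setsG: "sets G = sets borel"
    unfolding G(1) sets_pair_measure_cong[OF hp(2) kp(2)] borel_prod ..
  have G1: "distr G borel fst = h" and G2: "distr G borel snd = k"
    using G(2,3) distr_cong[OF refl hp(2)[symmetric] refl, of G fst] distr_cong[OF refl kp(2)[symmetric] refl, of G snd]
    by auto
  have "space G = UNIV"
    using sets_eq_imp_space_eq[OF setsG] by simp
  then have "emeasure G (space G) = emeasure (distr G borel fst) UNIV"
    using measurable_cong_sets[OF setsG refl, of borel]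
    by (subst emeasure_distr) (auto simp: borel_measurable_fst_snd)
  then have "prob_space G"
    using prob_space.emeasure_space_1[OF hp(1)] hp(3) by (intro prob_spaceI) (simp add: G1)
  then have "G \<in> borel_probs"
    by (simp add: borel_probs_def setsG)
  moreover have "AE z in G. dist (snd (fst z)) (fst (snd z)) < e"
    using G(4) by eventually_elim (auto intro!: small)
  ultimately show thesis
    using G1 G2 that by blast
qed

text \<open>For nearly optimal couplings of \<open>\<mu>, \<nu>\<close> and of \<open>\<nu>, \<rho>\<close>, the extreme coordinates of
  their approximate gluing couple \<open>\<mu>\<close> with \<open>\<rho>\<close>. The distance between them is at most
  the sum of the two coupled distances and the gap \<open>e\<close> between the copies of the middle point,
  so Minkowski's inequality bounds the cost.\<close>

lemma wass_dist_triangle: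
  fixes \<mu> \<nu> \<rho> :: "'a::{metric_space, second_countable_topology} measure"
  assumes p: "1 \<le> p"
  shows "wass_dist p \<mu> \<rho> \<le> wass_dist p \<mu> \<nu> + wass_dist p \<nu> \<rho>"
proof (cases "wass_dist p \<mu> \<nu> = \<top> \<or> wass_dist p \<nu> \<rho> = \<top>")
  case True
  then have "wass_dist p \<mu> \<nu> + wass_dist p \<nu> \<rho> = \<top>"
    by (simp add: ennreal_add_eq_top)
  then show ?thesis
    by (simp only: top_greatest)
next
  case False
  then obtain r s where r: "0 \<le> r" "wass_dist p \<mu> \<nu> = ennreal r"
    and s: "0 \<le> s" "wass_dist p \<nu> \<rho> = ennreal s"
    by (cases "wass_dist p \<mu> \<nu>"; cases "wass_dist p \<nu> \<rho>") auto
  have "wass_dist p \<mu> \<rho> \<le> ennreal (r + s) + ennreal d" if "0 < d" for d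
  proof -
    \<comment> \<open>the error occurs three times: once for each coupling and once for the gap\<close>
    define e where "e = d / 3"
    have e: "0 < e" using \<open>0 < d\<close> by (simp add: e_def)
    obtain h where h: "h \<in> couplings \<mu> \<nu>" and hc: "transport_cost p h \<le> ennreal ((r + e) powr p)"
      using wass_dist_lessE[of p \<mu> \<nu> "r + e"] p r e by (auto simp: ennreal_less_iff)
    obtain k where k: "k \<in> couplings \<nu> \<rho>" and kc: "transport_cost p k \<le> ennreal ((s + e) powr p)"
      using wass_dist_lessE[of p \<nu> \<rho> "s + e"] p s e by (auto simp: ennreal_less_iff)
    note hD = couplingsD[OF h] and kD = couplingsD[OF k]
    obtain G where G: "G \<in> borel_probs" "distr G borel fst = h" "distr G borel snd = k"
      and near: "AE z in G. dist (snd (fst z)) (fst (snd z)) < e"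
      using approximate_gluing[OF h k e] by blast
    let ?ends = "\<lambda>z :: ('a \<times> 'a) \<times> 'a \<times> 'a. (fst (fst z), snd (snd z))"
    let ?f = "\<lambda>z :: ('a \<times> 'a) \<times> 'a \<times> 'a. dist (fst (fst z)) (snd (fst z))"
    let ?g = "\<lambda>z :: ('a \<times> 'a) \<times> 'a \<times> 'a. dist (fst (snd z)) (snd (snd z))"
    have cont: "continuous_on UNIV ?ends" "continuous_on UNIV ?f" "continuous_on UNIV ?g"
      by (auto intro!: continuous_intros)
    have m: "?ends \<in> borel_measurable borel"
      using cont(1) by (rule borel_measurable_continuous_onI)
    have [measurable]: "?f \<in> borel_measurable G" "?g \<in> borel_measurable G"
      unfolding measurable_from_borel_probs[OF G(1)]
      using cont(2,3) by (auto intro!: borel_measurable_continuous_onI)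
    have ends: "fst \<circ> ?ends = fst \<circ> fst" "snd \<circ> ?ends = snd \<circ> snd"
      by auto
    have "distr G borel (fst \<circ> ?ends) = \<mu>" "distr G borel (snd \<circ> ?ends) = \<rho>"
      using hD(2) kD(3) unfolding ends G(2)[symmetric] G(3)[symmetric]
      by (simp_all add: distr_distr borel_measurable_fst_snd measurable_from_borel_probs[OF G(1)])
    moreover have "fst \<circ> ?ends \<in> borel_measurable borel" "snd \<circ> ?ends \<in> borel_measurable borel"
      unfolding ends by (auto intro!: measurable_comp borel_measurable_fst_snd)
    ultimately have end_coupling: "distr G borel ?ends \<in> couplings \<mu> \<rho>"
      using distr_in_couplings[OF G(1) m] by simp
    have fc: "(\<integral>\<^sup>+ z. ennreal (?f z powr p) \<partial>G) \<le> ennreal ((r + e) powr p)"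
      using hc transport_cost_distr[OF G(1) borel_measurable_fst_snd(1), of p] unfolding G(2) by simp
    have gc: "(\<integral>\<^sup>+ z. ennreal (?g z powr p) \<partial>G) \<le> ennreal ((s + e) powr p)"
      using kc transport_cost_distr[OF G(1) borel_measurable_fst_snd(2), of p] unfolding G(3) by simp
    have ec: "(\<integral>\<^sup>+ z. ennreal (e powr p) \<partial>G) \<le> ennreal (e powr p)"
      using prob_space.emeasure_space_1[OF borel_probsD(1)[OF G(1)]] by simp
    have "transport_cost p (distr G borel ?ends) = (\<integral>\<^sup>+ z. ennreal (dist (fst (fst z)) (snd (snd z)) powr p) \<partial>G)"
      by (simp add: transport_cost_distr[OF G(1) m])
    also have "\<dots> \<le> (\<integral>\<^sup>+ z. ennreal ((?f z + (e + ?g z)) powr p) \<partial>G)"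
    proof (rule nn_integral_mono_AE)
      show "AE z in G. ennreal (dist (fst (fst z)) (snd (snd z)) powr p) \<le> ennreal ((?f z + (e + ?g z)) powr p)"
        using near
      proof eventually_elim
        case (elim z)
        have "dist (fst (fst z)) (snd (snd z)) \<le> ?f z + (dist (snd (fst z)) (fst (snd z)) + ?g z)"
          using dist_triangle[of "fst (fst z)" "snd (snd z)" "snd (fst z)"]
            dist_triangle[of "snd (fst z)" "snd (snd z)" "fst (snd z)"]
          by linarith
        with elim show ?case
          using p by (intro ennreal_leI powr_mono2) auto
      qed
    qed
    also have "\<dots> \<le> ennreal ((r + e + (e + (s + e))) powr p)"
      using p r s e fc gc ec by (intro nn_integral_Minkowski) auto
    finally have "wass_dist p \<mu> \<rho> \<le> ennreal (r + e + (e + (s + e)))"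
      using end_coupling p r s e by (intro wass_dist_leI) auto
    also have "r + e + (e + (s + e)) = (r + s) + d"
      by (simp add: e_def)
    finally show ?thesis
      using r s \<open>0 < d\<close> by (simp add: ennreal_plus)
  qed
  then have "wass_dist p \<mu> \<rho> \<le> ennreal (r + s)"
    by (rule ennreal_le_epsilon)
  then show ?thesis
    using r s by (simp add: ennreal_plus)
qed

lemma return_in_borel_probs: "return borel x \<in> borel_probs"
  by (auto simp: borel_probs_def intro!: prob_space_return)

text \<open>Moving all mass to the point \<open>x0\<close> costs the \<open>p\<close>-th moment about \<open>x0\<close>.\<close>

lemma wass_dist_return_finite:
  fixes \<mu> :: "'a::metric_space measure"
  assumes \<mu>: "\<mu> \<in> borel_probs" and p: "0 < p"
    and fin: "(\<integral>\<^sup>+ x. ennreal (dist x x0 powr p) \<partial>\<mu>) < \<infinity>"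
  shows "wass_dist p \<mu> (return borel x0) < \<infinity>"
proof -
  let ?f = "\<lambda>x :: 'a. (x, x0)"
  have m: "?f \<in> borel_measurable borel" "(\<lambda>x::'a. x) \<in> borel_measurable borel"
    by (auto intro!: borel_measurable_continuous_onI continuous_intros)
  have "distr \<mu> borel (\<lambda>x. x) = \<mu>"
    using borel_probsD[OF \<mu>] by (intro measure_eqI) (simp_all add: emeasure_distr measurable_from_borel_probs[OF \<mu>])
  moreover have "distr \<mu> borel (\<lambda>x. x0) = return borel x0"
    using borel_probsD(1)[OF \<mu>] by (intro prob_space.distr_const) simp_all
  moreover have "fst \<circ> ?f = (\<lambda>x. x)" "snd \<circ> ?f = (\<lambda>x. x0)"
    by auto
  ultimately have "distr \<mu> borel ?f \<in> couplings \<mu> (return borel x0)"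
    using distr_in_couplings[OF \<mu> m(1)] m(2) by (metis borel_measurable_const)
  moreover define c where "c = enn2real (transport_cost p (distr \<mu> borel ?f))"
  moreover have "transport_cost p (distr \<mu> borel ?f) < \<infinity>"
    unfolding transport_cost_distr[OF \<mu> m(1)] fst_conv snd_conv by (fact fin)
  then have "transport_cost p (distr \<mu> borel ?f) = ennreal c"
    unfolding c_def infinity_ennreal_def by (rule ennreal_enn2real[symmetric])
  then have "transport_cost p (distr \<mu> borel ?f) \<le> ennreal ((c powr (1 / p)) powr p)"
    using p enn2real_nonneg by (simp only: c_def powr_powr) simp
  ultimately have "wass_dist p \<mu> (return borel x0) \<le> ennreal (c powr (1 / p))"
    using p by (intro wass_dist_leI) simp_all
  also have "\<dots> < \<infinity>"
    by simp
  finally show ?thesis .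
qed

text \<open>The moments may be taken at different base points, so the path from \<open>\<mu>\<close> to \<open>\<nu>\<close> runs
  through two point masses.\<close>

lemma wass_dist_finite:
  fixes \<mu> \<nu> :: "'a::{metric_space, second_countable_topology} measure"
  assumes p: "1 \<le> p" and \<mu>: "\<mu> \<in> wass_space p" and \<nu>: "\<nu> \<in> wass_space p"
  shows "wass_dist p \<mu> \<nu> < \<infinity>"
proof -
  have to_dirac: "\<exists>x0. wass_dist p \<kappa> (return borel x0) < \<infinity>" if \<kappa>: "\<kappa> \<in> wass_space p" for \<kappa> :: "'a measure"
  proof -
    obtain x0 where "\<kappa> \<in> borel_probs" "(\<integral>\<^sup>+ x. ennreal (dist x x0 powr p) \<partial>\<kappa>) < \<infinity>"
      using \<kappa> unfolding wass_space_def by blast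
    then have "wass_dist p \<kappa> (return borel x0) < \<infinity>"
      using p by (intro wass_dist_return_finite) simp_all
    then show ?thesis ..
  qed
  obtain x0 y0 where fin: "wass_dist p \<mu> (return borel x0) < \<infinity>" "wass_dist p \<nu> (return borel y0) < \<infinity>"
    using to_dirac[OF \<mu>] to_dirac[OF \<nu>] by blast
  have diracs: "wass_dist p (return borel x0) (return borel y0) < \<infinity>"
  proof (intro wass_dist_return_finite return_in_borel_probs)
    have [measurable]: "(\<lambda>x. dist x y0) \<in> borel_measurable borel"
      by (intro borel_measurable_continuous_onI continuous_intros)
    show "(\<integral>\<^sup>+ x. ennreal (dist x y0 powr p) \<partial>return borel x0) < \<infinity>"
      by (subst nn_integral_return) simp_all
  qed (use p in simp)
  have "wass_dist p \<mu> \<nu> \<le> wass_dist p \<mu> (return borel x0) + wass_dist p (return borel x0) \<nu>"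
    by (rule wass_dist_triangle[OF p])
  also have "\<dots> \<le> wass_dist p \<mu> (return borel x0) +
      (wass_dist p (return borel x0) (return borel y0) + wass_dist p (return borel y0) \<nu>)"
    by (intro add_left_mono wass_dist_triangle[OF p])
  also have "\<dots> < \<infinity>"
    using fin diracs by (simp add: wass_dist_commute[of p "return borel y0"])
  finally show ?thesis .
qed

section \<open>Separation of measures on the line\<close>

text \<open>By Markov's inequality, a coupling of small cost moves little mass further than \<open>e\<close>. Hence
  \<open>cdf \<mu> t\<close> exceeds \<open>cdf \<nu> (t + e)\<close> by at most \<open>e\<close>, and \<open>e\<close> tends to 0 by right
  continuity.\<close>

lemma wass_dist_zero_imp_cdf_le:
  fixes \<mu> \<nu> :: "real measure"
  assumes p: "0 < p" and \<mu>: "\<mu> \<in> borel_probs" and \<nu>: "\<nu> \<in> borel_probs"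
    and zero: "wass_dist p \<mu> \<nu> = 0"
  shows "cdf \<mu> t \<le> cdf \<nu> t"
proof -
  interpret \<mu>: prob_space \<mu> using \<mu> by (rule borel_probsD)
  interpret \<nu>: prob_space \<nu> using \<nu> by (rule borel_probsD)
  have \<nu>_dist: "real_distribution \<nu>"
    using borel_probsD[OF \<nu>] by (simp add: real_distribution_def real_distribution_axioms_def)
  have shift: "cdf \<mu> t \<le> cdf \<nu> (t + e) + e" if "0 < e" for e
  proof -
    \<comment> \<open>a coupling of cost at most \<open>e * e powr p\<close> moves mass at most \<open>e\<close> by \<open>e\<close> or more\<close>
    define a where "a = e * e powr (1 / p)"
    have a: "0 < a" "a powr p = e * e powr p"
      using that p by (simp_all add: a_def powr_mult powr_powr mult.commute)
    have "wass_dist p \<mu> \<nu> < ennreal a"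
      using zero a by simp
    then obtain h where h: "h \<in> couplings \<mu> \<nu>" "transport_cost p h \<le> ennreal (a powr p)"
      using wass_dist_lessE p by blast
    note hD = couplingsD[OF h(1)]
    interpret h: prob_space h using hD(1) by (rule borel_probsD)
    have [measurable]: "fst \<in> borel_measurable h" "snd \<in> borel_measurable h"
      by (simp_all add: measurable_from_borel_probs[OF hD(1)] borel_measurable_fst_snd)
    have sp: "space h = UNIV" using borel_probsD[OF hD(1)] by simp
    let ?far = "{z \<in> space h. e powr p \<le> dist (fst z) (snd z) powr p}"
    have "ennreal (e powr p) * emeasure h ?far = (\<integral>\<^sup>+ z. ennreal (e powr p) * indicator ?far z \<partial>h)"
      by (subst nn_integral_cmult_indicator) auto
    also have "\<dots> \<le> transport_cost p h"
      by (intro nn_integral_mono) (auto split: split_indicator intro: ennreal_leI)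
    also have "\<dots> \<le> ennreal (e * e powr p)"
      using h(2) a by simp
    finally have "e powr p * measure h ?far \<le> e powr p * e"
      using that by (simp add: h.emeasure_eq_measure mult.commute flip: ennreal_mult)
    then have far: "measure h ?far \<le> e"
      using that by simp
    have "cdf \<mu> t = measure h {z \<in> space h. fst z \<le> t}"
      unfolding cdf_def hD(2)[symmetric] by (subst measure_distr) (auto simp: vimage_def Int_def conj_commute)
    also have "\<dots> \<le> measure h ({z \<in> space h. snd z \<le> t + e} \<union> ?far)"
    proof (rule h.finite_measure_mono)
      show "{z \<in> space h. fst z \<le> t} \<subseteq> {z \<in> space h. snd z \<le> t + e} \<union> ?far"
      proof
        fix z assume "z \<in> {z \<in> space h. fst z \<le> t}"
        then show "z \<in> {z \<in> space h. snd z \<le> t + e} \<union> ?far"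
          using that p by (cases "snd z \<le> t + e") (auto simp: dist_real_def intro!: powr_mono2)
      qed
    qed measurable
    also have "\<dots> \<le> measure h {z \<in> space h. snd z \<le> t + e} + measure h ?far"
      by (rule measure_Un_le) auto
    also have "measure h {z \<in> space h. snd z \<le> t + e} = cdf \<nu> (t + e)"
      unfolding cdf_def hD(3)[symmetric] by (subst measure_distr) (auto simp: vimage_def Int_def conj_commute)
    finally show ?thesis
      using far by simp
  qed
  have "(cdf \<nu> \<longlongrightarrow> cdf \<nu> t) (at_right t)"
    using finite_borel_measure.cdf_is_right_cont[OF real_distribution.finite_borel_measure_M[OF \<nu>_dist]]
    by (simp add: continuous_within)
  moreover have "((\<lambda>x. x - t) \<longlongrightarrow> t - t) (at_right t)"
    by (intro tendsto_intros)
  ultimately have "((\<lambda>x. cdf \<nu> x + (x - t)) \<longlongrightarrow> cdf \<nu> t + (t - t)) (at_right t)"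
    by (rule tendsto_add)
  moreover have "\<forall>\<^sub>F x in at_right t. cdf \<mu> t \<le> cdf \<nu> x + (x - t)"
    using eventually_at_right_less[of t]
  proof eventually_elim
    case (elim x)
    then show ?case
      using shift[of "x - t"] by simp
  qed
  ultimately have "cdf \<mu> t \<le> cdf \<nu> t + (t - t)"
    by (rule tendsto_lowerbound) simp
  then show ?thesis
    by simp
qed

lemma wass_dist_zero_imp_eq:
  fixes \<mu> \<nu> :: "real measure"
  assumes "0 < p" "\<mu> \<in> borel_probs" "\<nu> \<in> borel_probs" "wass_dist p \<mu> \<nu> = 0"
  shows "\<mu> = \<nu>"
proof (rule cdf_unique)
  show "real_distribution \<mu>" "real_distribution \<nu>"
    using borel_probsD[OF assms(2)] borel_probsD[OF assms(3)]
    by (simp_all add: real_distribution_def real_distribution_axioms_def)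
  show "cdf \<mu> = cdf \<nu>"
    using assms by (intro ext antisym wass_dist_zero_imp_cdf_le[of p]) (simp_all add: wass_dist_commute[of p \<nu>])
qed

section \<open>Metrics obtained from families of Lipschitz functions\<close>

lemma SUP_wass_dist_lipschitz_le:
  assumes "F \<subseteq> Lip1" "0 \<le> p"
  shows "(SUP f\<in>F. wass_dist p (distr \<mu> borel f) (distr \<nu> borel f)) \<le> wass_dist p \<mu> \<nu>"
  using assms by (intro SUP_least wass_dist_lipschitz_le) (auto simp: Lip1_def)

text \<open>Symmetry and the triangle inequality pass to suprema, and finiteness follows from the bound
  by \<open>wass_dist\<close>, for every family of 1-Lipschitz functions. Only separation depends on the family: it says that the
  pushforwards determine the measure, because \<open>wass_dist\<close> separates measures on the line.\<close>

lemma real_metric_on_SUP_wass_dist: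
  fixes F :: "('a::{metric_space, second_countable_topology} \<Rightarrow> real) set"
  assumes p: "1 \<le> p" and F: "F \<subseteq> Lip1" and M: "M \<subseteq> wass_space p"
    and sep: "\<And>\<mu> \<nu>. \<mu> \<in> M \<Longrightarrow> \<nu> \<in> M \<Longrightarrow> (\<And>f. f \<in> F \<Longrightarrow> distr \<mu> borel f = distr \<nu> borel f) \<Longrightarrow> \<mu> = \<nu>"
  shows "real_metric_on M (\<lambda>\<mu> \<nu>. SUP f\<in>F. wass_dist p (distr \<mu> borel f) (distr \<nu> borel f))"
proof -
  define D where "D \<mu> \<nu> = (SUP f\<in>F. wass_dist p (distr \<mu> borel f) (distr \<nu> borel f))" for \<mu> \<nu> :: "'a measure"
  have push: "distr \<mu> borel f \<in> borel_probs" if "\<mu> \<in> M" "f \<in> F" for \<mu> f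
    using that F M
    by (intro distr_in_borel_probs lipschitz_borel_measurable[of 1]) (auto simp: wass_space_def Lip1_def)
  have fin: "D \<mu> \<nu> < \<infinity>" if "\<mu> \<in> M" "\<nu> \<in> M" for \<mu> \<nu>
  proof -
    have "D \<mu> \<nu> \<le> wass_dist p \<mu> \<nu>"
      unfolding D_def using F p by (intro SUP_wass_dist_lipschitz_le) simp_all
    also have "\<dots> < \<infinity>"
      using that M by (intro wass_dist_finite[OF p]) auto
    finally show ?thesis .
  qed
  have triangle: "D \<mu> \<rho> \<le> D \<mu> \<nu> + D \<nu> \<rho>" for \<mu> \<nu> \<rho>
    unfolding D_def
  proof (rule SUP_least)
    fix f assume "f \<in> F"
    have "wass_dist p (distr \<mu> borel f) (distr \<rho> borel f) \<le>
        wass_dist p (distr \<mu> borel f) (distr \<nu> borel f) + wass_dist p (distr \<nu> borel f) (distr \<rho> borel f)"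
      by (rule wass_dist_triangle[OF p])
    also have "\<dots> \<le> (SUP f\<in>F. wass_dist p (distr \<mu> borel f) (distr \<nu> borel f)) +
        (SUP f\<in>F. wass_dist p (distr \<nu> borel f) (distr \<rho> borel f))"
      using \<open>f \<in> F\<close> by (intro add_mono SUP_upper)
    finally show "wass_dist p (distr \<mu> borel f) (distr \<rho> borel f) \<le> \<dots>" .
  qed
  have zero: "D \<mu> \<nu> = 0 \<longleftrightarrow> \<mu> = \<nu>" if "\<mu> \<in> M" "\<nu> \<in> M" for \<mu> \<nu>
  proof
    assume "D \<mu> \<nu> = 0"
    show "\<mu> = \<nu>"
    proof (rule sep[OF that])
      fix f assume "f \<in> F"
      then have "wass_dist p (distr \<mu> borel f) (distr \<nu> borel f) \<le> D \<mu> \<nu>"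
        unfolding D_def by (rule SUP_upper)
      then show "distr \<mu> borel f = distr \<nu> borel f"
        using p that \<open>f \<in> F\<close> \<open>D \<mu> \<nu> = 0\<close> by (intro wass_dist_zero_imp_eq[of p] push) simp_all
    qed
  next
    assume "\<mu> = \<nu>"
    have "D \<mu> \<mu> \<le> 0"
      unfolding D_def using p that by (intro SUP_least) (simp add: wass_dist_self push)
    then show "D \<mu> \<nu> = 0"
      using \<open>\<mu> = \<nu>\<close> by simp
  qed
  have "Metric_space M (\<lambda>\<mu> \<nu>. enn2real (D \<mu> \<nu>))"
  proof
    show "enn2real (D \<mu> \<nu>) = enn2real (D \<nu> \<mu>)" for \<mu> \<nu>
      unfolding D_def by (subst wass_dist_commute) (rule refl)
    show "enn2real (D \<mu> \<nu>) = 0 \<longleftrightarrow> \<mu> = \<nu>" if "\<mu> \<in> M" "\<nu> \<in> M" for \<mu> \<nu>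
      using fin[OF that] zero[OF that] by (auto simp: enn2real_eq_0_iff)
    show "enn2real (D \<mu> \<rho>) \<le> enn2real (D \<mu> \<nu>) + enn2real (D \<nu> \<rho>)"
      if "\<mu> \<in> M" "\<nu> \<in> M" "\<rho> \<in> M" for \<mu> \<nu> \<rho>
    proof -
      have "enn2real (D \<mu> \<rho>) \<le> enn2real (D \<mu> \<nu> + D \<nu> \<rho>)"
        using triangle fin[OF that(1,2)] fin[OF that(2,3)] by (intro enn2real_mono) simp_all
      then show ?thesis
        using fin[OF that(1,2)] fin[OF that(2,3)] by (simp add: enn2real_plus)
    qed
  qed simp
  then have "real_metric_on M D"
    using fin by (simp add: real_metric_on_def)
  then show ?thesis
    by (simp add: D_def[abs_def])
qed

text \<open>A shorter list of points and factors is padded by repeating its last entry.\<close>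

lemma min_dist_fin_mono:
  assumes "k \<le> l"
  shows "min_dist_fin k \<subseteq> min_dist_fin l"
proof
  fix f :: "'a \<Rightarrow> real" assume "f \<in> min_dist_fin k"
  then obtain \<alpha> a where f: "f = (\<lambda>x. Min ((\<lambda>i. \<alpha> i * dist x (a i)) ` {..k}))" "\<forall>i\<le>k. \<alpha> i \<in> {0..1}"
    unfolding min_dist_fin_def by blast
  have "min k ` {..l} = {..k}"
  proof (intro equalityI subsetI)
    fix i assume "i \<in> {..k}"
    then show "i \<in> min k ` {..l}"
      using assms by (intro image_eqI[of _ _ i]) auto
  qed auto
  then have "f = (\<lambda>x. Min ((\<lambda>i. \<alpha> (min k i) * dist x (a (min k i))) ` {..l}))"
    unfolding f(1) using image_image[of "\<lambda>i. \<alpha> i * dist x (a i)" "min k" "{..l}" for x] by simp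
  then show "f \<in> min_dist_fin l"
    unfolding min_dist_fin_def using f(2) by (intro CollectI exI[of _ "\<alpha> \<circ> min k"] exI[of _ "a \<circ> min k"]) simp
qed

lemma min_dist_mono:
  assumes "m \<le> n"
  shows "min_dist m \<subseteq> min_dist n"
  using assms by (cases m; cases n) (auto simp: min_dist_def dest: subsetD[OF min_dist_fin_mono])

text \<open>The minimum at \<open>y\<close> is attained at some index \<open>i\<close>, and the \<open>i\<close>-th function grows by
  at most \<open>dist x y\<close> from \<open>y\<close> to \<open>x\<close>.\<close>

lemma min_dist_fin_subset_Lip1: "min_dist_fin k \<subseteq> Lip1"
proof
  fix f :: "'a \<Rightarrow> real" assume "f \<in> min_dist_fin k"
  then obtain \<alpha> a where f: "f = (\<lambda>x. Min ((\<lambda>i. \<alpha> i * dist x (a i)) ` {..k}))"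
    and \<alpha>: "\<And>i. i \<le> k \<Longrightarrow> 0 \<le> \<alpha> i \<and> \<alpha> i \<le> 1"
    unfolding min_dist_fin_def by auto
  have le: "f x \<le> f y + dist x y" for x y
  proof -
    have "f y \<in> (\<lambda>i. \<alpha> i * dist y (a i)) ` {..k}"
      unfolding f by (intro Min_in) auto
    then obtain i where i: "i \<le> k" "f y = \<alpha> i * dist y (a i)"
      by auto
    have "f x \<le> \<alpha> i * dist x (a i)"
      unfolding f using i(1) by (intro Min_le) auto
    also have "\<dots> \<le> \<alpha> i * (dist y (a i) + dist x y)"
      using \<alpha>[OF i(1)] by (intro mult_left_mono) (metis dist_triangle add.commute, simp)
    also have "\<dots> \<le> f y + dist x y"
      using \<alpha>[OF i(1)] mult_right_mono[of "\<alpha> i" 1 "dist x y"] by (simp add: i(2) distrib_left)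
    finally show ?thesis .
  qed
  have "1-lipschitz_on UNIV f"
  proof (rule lipschitz_onI)
    fix x y
    show "dist (f x) (f y) \<le> 1 * dist x y"
      using le[of x y] le[of y x] by (simp add: dist_real_def dist_commute)
  qed simp
  then show "f \<in> Lip1"
    by (simp add: Lip1_def)
qed

lemma min_dist_subset_Lip1: "min_dist n \<subseteq> Lip1"
  using min_dist_fin_subset_Lip1 by (fastforce simp: min_dist_def split: enat.splits)

section \<open>Measures determined by unions of balls\<close>

definition open_balls :: "'a::metric_space set set" where
  "open_balls = {ball x r | x r. 0 < r}"

text \<open>A union of \<open>k + 1\<close> balls is a strict sublevel set of a single function in
  \<open>min_dist_fin k\<close>: the inequality \<open>dist x (a i) < r i\<close> is rescaled to
  \<open>t / r i * dist x (a i) < t\<close>.\<close>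

lemma emeasure_UN_balls_eq:
  fixes \<mu> \<nu> :: "'a::metric_space measure"
  assumes \<mu>: "\<mu> \<in> borel_probs" and \<nu>: "\<nu> \<in> borel_probs"
    and eq: "\<And>f. f \<in> min_dist_fin k \<Longrightarrow> distr \<mu> borel f = distr \<nu> borel f"
    and r: "\<And>i. i \<le> k \<Longrightarrow> 0 < r i"
  shows "emeasure \<mu> (\<Union>i\<le>k. ball (a i) (r i)) = emeasure \<nu> (\<Union>i\<le>k. ball (a i) (r i))"
proof -
  \<comment> \<open>the smallest radius is a level for which all factors \<open>t / r i\<close> lie in the unit interval\<close>
  define t where "t = Min (r ` {..k})"
  have t: "0 < t" "\<And>i. i \<le> k \<Longrightarrow> t \<le> r i"
    using r by (auto simp: t_def)
  define f where "f x = Min ((\<lambda>i. t / r i * dist x (a i)) ` {..k})" for x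
  have f_in: "f \<in> min_dist_fin k"
    unfolding min_dist_fin_def f_def[abs_def] using t r
    by (intro CollectI exI[of _ "\<lambda>i. t / r i"] exI[of _ a]) (auto simp: less_imp_le)
  then have "f \<in> Lip1"
    using min_dist_fin_subset_Lip1 by auto
  then have mf: "f \<in> borel_measurable borel"
    by (auto simp: Lip1_def intro: lipschitz_borel_measurable)
  have level: "f -` {..<t} = (\<Union>i\<le>k. ball (a i) (r i))"
  proof -
    have "f x < t \<longleftrightarrow> (\<exists>i\<le>k. t / r i * dist x (a i) < t)" for x
      unfolding f_def by (subst Min_less_iff) auto
    moreover have "t / r i * d < t \<longleftrightarrow> d < r i" if "i \<le> k" for i d
      using t r[OF that] by (simp add: field_simps)
    ultimately have "f x < t \<longleftrightarrow> (\<exists>i\<le>k. dist x (a i) < r i)" for x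
      by blast
    then show ?thesis
      by (auto simp: dist_commute)
  qed
  have "emeasure \<kappa> (f -` {..<t}) = emeasure (distr \<kappa> borel f) {..<t}" if "\<kappa> \<in> borel_probs" for \<kappa>
    using borel_probsD[OF that] mf by (subst emeasure_distr) (simp_all add: measurable_from_borel_probs[OF that])
  then show ?thesis
    using \<mu> \<nu> eq[OF f_in] by (simp add: level)
qed

text \<open>The same for a set of balls. If it has fewer than \<open>k + 1\<close> members, one of them is listed
  repeatedly.\<close>

lemma emeasure_Union_balls_eq:
  fixes \<mu> \<nu> :: "'a::metric_space measure"
  assumes "\<mu> \<in> borel_probs" "\<nu> \<in> borel_probs"
    and "\<And>f. f \<in> min_dist_fin k \<Longrightarrow> distr \<mu> borel f = distr \<nu> borel f"
    and K: "K \<subseteq> open_balls" "finite K" "card K \<le> k + 1"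
  shows "emeasure \<mu> (\<Union>K) = emeasure \<nu> (\<Union>K)"
proof (cases "K = {}")
  case False
  obtain e where e: "bij_betw e {0..<card K} K"
    using ex_bij_betw_nat_finite[OF K(2)] by blast
  have pos: "0 < card K"
    using False K(2) by (simp add: card_gt_0_iff)
  define b where "b i = e (if i < card K then i else 0)" for i
  have im: "b ` {..k} = K"
  proof
    show "b ` {..k} \<subseteq> K"
      using bij_betwE[OF e] pos by (auto simp: b_def)
    show "K \<subseteq> b ` {..k}"
    proof
      fix B assume "B \<in> K"
      then have "B \<in> e ` {0..<card K}"
        using bij_betw_imp_surj_on[OF e] by simp
      then obtain i where "i < card K" "B = e i"
        by auto
      then show "B \<in> b ` {..k}"
        using K(3) by (intro image_eqI[of _ _ i]) (auto simp: b_def)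
    qed
  qed
  have "\<exists>x r. b i = ball x r \<and> 0 < r" if "i \<le> k" for i
  proof -
    have "b i \<in> open_balls"
      using im K(1) that by blast
    then show ?thesis
      by (simp add: open_balls_def)
  qed
  then obtain a r where ar: "\<And>i. i \<le> k \<Longrightarrow> b i = ball (a i) (r i)" "\<And>i. i \<le> k \<Longrightarrow> 0 < r i"
    by metis
  have "\<Union>K = (\<Union>i\<le>k. ball (a i) (r i))"
    unfolding im[symmetric] using ar(1) by auto
  then show ?thesis
    using emeasure_UN_balls_eq[where a = a and r = r and k = k, OF assms(1-3) ar(2)] by simp
qed simp

lemma emeasure_countable_Union_eqI:
  assumes "countable V" "V \<subseteq> sets \<mu>" "sets \<nu> = sets \<mu>"
    and eq: "\<And>K. finite K \<Longrightarrow> K \<subseteq> V \<Longrightarrow> emeasure \<mu> (\<Union>K) = emeasure \<nu> (\<Union>K)"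
  shows "emeasure \<mu> (\<Union>V) = emeasure \<nu> (\<Union>V)"
proof (cases "V = {}")
  case False
  define A where "A n = \<Union>(from_nat_into V ` {..n})" for n :: nat
  have "\<Union>V = \<Union>(range (from_nat_into V))"
    by (simp only: range_from_nat_into[OF False assms(1)])
  also have "\<dots> = (\<Union>n. A n)"
    by (auto simp: A_def)
  finally have "\<Union>V = (\<Union>n. A n)" .
  moreover have "emeasure \<mu> (A n) = emeasure \<nu> (A n)" for n
    unfolding A_def using False by (intro eq) (auto intro: from_nat_into)
  moreover have "incseq A"
    by (auto simp: A_def incseq_def intro: order_trans)
  moreover have "range A \<subseteq> sets \<mu>"
    using assms(2) from_nat_into[OF False] by (auto simp: A_def intro!: sets.finite_UN)
  ultimately show ?thesis
    using SUP_emeasure_incseq[of A \<mu>] SUP_emeasure_incseq[of A \<nu>] assms(3) by simp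
qed simp

text \<open>In the inclusion-exclusion formula for \<open>f (\<Union>A)\<close>, induction on \<open>A\<close> makes every
  term vanish except the one of \<open>\<Inter>A\<close>.\<close>

lemma Incl_Excl_Inter_eq_0:
  fixes f :: "'a set \<Rightarrow> real"
  assumes "Incl_Excl P f" "finite A" "A \<noteq> {}" "\<And>S. S \<in> A \<Longrightarrow> P S"
    and "\<And>B. B \<subseteq> A \<Longrightarrow> f (\<Union>B) = 0"
  shows "f (\<Inter>A) = 0"
  using assms(2-)
proof (induction A rule: finite_psubset_induct)
  case (psubset A)
  interpret Incl_Excl P f by fact
  have "0 = f (\<Union>A)"
    using psubset.prems by simp
  also have "\<dots> = (\<Sum>B | B \<subseteq> A \<and> B \<noteq> {}. (- 1) ^ (card B + 1) * f (\<Inter>B))"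
    using psubset.hyps psubset.prems by (intro restricted) auto
  also have "\<dots> = (\<Sum>B\<in>{A}. (- 1) ^ (card B + 1) * f (\<Inter>B))"
  proof (rule sum.mono_neutral_right)
    show "finite {B. B \<subseteq> A \<and> B \<noteq> {}}"
      using psubset.hyps by simp
    show "\<forall>B\<in>{B. B \<subseteq> A \<and> B \<noteq> {}} - {A}. (- 1) ^ (card B + 1) * f (\<Inter>B) = 0"
    proof
      fix B assume "B \<in> {B. B \<subseteq> A \<and> B \<noteq> {}} - {A}"
      then have "B \<subset> A" "B \<noteq> {}" by auto
      then have "f (\<Inter>B) = 0"
        using psubset.prems by (intro psubset.IH) auto
      then show "(- 1) ^ (card B + 1) * f (\<Inter>B) = 0" by simp
    qed
  qed (use psubset.prems in auto)
  finally show ?case by simp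
qed

text \<open>The intersections of at most \<open>N\<close> members are controlled by the small unions through the
  previous lemma, the others by assumption; inclusion-exclusion then covers \<open>\<Union>A\<close>.\<close>

lemma Incl_Excl_Union_eq_0:
  fixes f :: "'a set \<Rightarrow> real"
  assumes ie: "Incl_Excl P f" and A: "finite A" "\<And>S. S \<in> A \<Longrightarrow> P S"
    and small: "\<And>B. B \<subseteq> A \<Longrightarrow> card B \<le> N \<Longrightarrow> f (\<Union>B) = 0"
    and large: "\<And>B. B \<subseteq> A \<Longrightarrow> N < card B \<Longrightarrow> f (\<Inter>B) = 0"
  shows "f (\<Union>A) = 0"
proof -
  interpret Incl_Excl P f by fact
  have "f (\<Inter>B) = 0" if B: "B \<subseteq> A" "B \<noteq> {}" for B
  proof (cases "card B \<le> N")
    case True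
    have finB: "finite B" using A(1) B(1) by (rule finite_subset[rotated])
    show ?thesis
    proof (rule Incl_Excl_Inter_eq_0[OF ie finB B(2)])
      fix C assume "C \<subseteq> B"
      then show "f (\<Union>C) = 0"
        using B(1) True card_mono[OF finB \<open>C \<subseteq> B\<close>] by (intro small) auto
    qed (use A B in auto)
  qed (use large B in auto)
  then have "(\<Sum>B | B \<subseteq> A \<and> B \<noteq> {}. (- 1) ^ (card B + 1) * f (\<Inter>B)) = 0"
    by (intro sum.neutral) auto
  then show ?thesis
    using restricted[of A] A by simp
qed

text \<open>Inclusion-exclusion applied to the difference of the two measures. In a family of order at
  most \<open>N\<close>, the unions of at most \<open>N\<close> members determine the measure of all unions.\<close>

lemma emeasure_Union_eq_of_small_unions:
  assumes "finite_measure \<mu>" "finite_measure \<nu>" and sets: "sets \<nu> = sets \<mu>"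
    and A: "finite A" "A \<subseteq> sets \<mu>"
    and small: "\<And>B. B \<subseteq> A \<Longrightarrow> card B \<le> N \<Longrightarrow> emeasure \<mu> (\<Union>B) = emeasure \<nu> (\<Union>B)"
    and large: "\<And>B. B \<subseteq> A \<Longrightarrow> N < card B \<Longrightarrow> \<Inter>B = {}"
  shows "emeasure \<mu> (\<Union>A) = emeasure \<nu> (\<Union>A)"
proof -
  interpret \<mu>: finite_measure \<mu> by fact
  interpret \<nu>: finite_measure \<nu> by fact
  define f where "f S = measure \<mu> S - measure \<nu> S" for S
  have ie: "Incl_Excl (\<lambda>S. S \<in> sets \<mu>) f"
    by unfold_locales
      (auto simp: f_def sets disjnt_def \<mu>.finite_measure_Union \<nu>.finite_measure_Union)
  have "f (\<Union>A) = 0"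
  proof (rule Incl_Excl_Union_eq_0[OF ie A(1)])
    show "f (\<Union>B) = 0" if "B \<subseteq> A" "card B \<le> N" for B
      using small[OF that] by (simp add: f_def measure_def)
    show "f (\<Inter>B) = 0" if "B \<subseteq> A" "N < card B" for B
      using large[OF that] by (simp add: f_def)
  qed (use A in auto)
  then show ?thesis
    by (simp add: f_def \<mu>.emeasure_eq_measure \<nu>.emeasure_eq_measure)
qed

text \<open>The complement is a union of open null sets, and countably many of them suffice
  in a second countable space.\<close>

lemma emeasure_Compl_msupport:
  fixes \<mu> :: "'a::{metric_space, second_countable_topology} measure"
  assumes "sets \<mu> = sets borel"
  shows "- msupport \<mu> \<in> null_sets \<mu>"
proof -
  define \<N> where "\<N> = {U. open U \<and> emeasure \<mu> U = 0}"
  have "- msupport \<mu> = \<Union>\<N>"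
    by (auto simp: msupport_def \<N>_def)
  moreover obtain \<N>' where \<N>': "\<N>' \<subseteq> \<N>" "countable \<N>'" "\<Union>\<N>' = \<Union>\<N>"
    using Lindelof[of \<N>] by (auto simp: \<N>_def)
  moreover have "(\<Union>U\<in>\<N>'. U) \<in> null_sets \<mu>"
  proof (rule null_sets_UN'[OF \<N>'(2)])
    fix U assume "U \<in> \<N>'"
    then have "open U" "emeasure \<mu> U = 0"
      using \<N>'(1) by (auto simp: \<N>_def)
    then show "U \<in> null_sets \<mu>"
      using assms by (intro null_setsI) simp_all
  qed
  ultimately show ?thesis
    by simp
qed

lemma borel_probs_eqI_open:
  fixes \<mu> \<nu> :: "'a::metric_space measure"
  assumes "\<mu> \<in> borel_probs" "\<nu> \<in> borel_probs"
    and "\<And>U. open U \<Longrightarrow> emeasure \<mu> U = emeasure \<nu> U"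
  shows "\<mu> = \<nu>"
proof (rule measure_eqI_generator_eq[where E = "{U. open U}" and \<Omega> = UNIV and A = "\<lambda>_. UNIV"])
  interpret prob_space \<mu> using assms(1) by (rule borel_probsD)
  show "emeasure \<mu> UNIV \<noteq> \<infinity>" for i :: nat
    by simp
  have "sets borel = sigma_sets UNIV {U :: 'a set. open U}"
    unfolding borel_def by (rule sets_measure_of) simp
  then show "sets \<mu> = sigma_sets UNIV {U. open U}" "sets \<nu> = sigma_sets UNIV {U. open U}"
    using borel_probsD(2)[OF assms(1)] borel_probsD(2)[OF assms(2)] by simp_all
  show "Int_stable {U :: 'a set. open U}"
    by (auto simp: Int_stable_def)
  show "emeasure \<mu> X = emeasure \<nu> X" if "X \<in> {U. open U}" for X
    using assms(3) that by simp
qed auto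

text \<open>For a closed \<open>C \<subseteq> U\<close>, the cover \<open>{U, - C}\<close> of the support of \<open>\<mu>\<close> is refined by
  balls of which no \<open>n + 2\<close> meet. The balls of the refinement inside \<open>U\<close> have a union
  that contains \<open>C\<close> up to a \<open>\<mu>\<close>-null set, and both measures agree on this union. Hence
  \<open>emeasure \<mu> C \<le> emeasure \<nu> U\<close>, and inner regularity of \<open>\<mu>\<close> replaces \<open>C\<close> by
  \<open>U\<close>.\<close>

lemma emeasure_open_le_of_small_ball_unions:
  fixes \<mu> \<nu> :: "'a::polish_space measure"
  assumes \<mu>: "\<mu> \<in> borel_probs" and \<nu>: "\<nu> \<in> borel_probs"
    and dim: "ball_covering_dim_le (msupport \<mu>) n"
    and balls: "\<And>K. K \<subseteq> open_balls \<Longrightarrow> finite K \<Longrightarrow> card K \<le> n + 1 \<Longrightarrow>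
      emeasure \<mu> (\<Union>K) = emeasure \<nu> (\<Union>K)"
    and U: "open U"
  shows "emeasure \<mu> U \<le> emeasure \<nu> U"
proof -
  interpret \<mu>: prob_space \<mu> using \<mu> by (rule borel_probsD)
  interpret \<nu>: prob_space \<nu> using \<nu> by (rule borel_probsD)
  note sets = borel_probsD(2)[OF \<mu>] borel_probsD(2)[OF \<nu>]
  have closed_le: "emeasure \<mu> C \<le> emeasure \<nu> U" if C: "closed C" "C \<subseteq> U" for C
  proof -
    have cover: "(\<forall>W\<in>{U, - C}. open W) \<and> msupport \<mu> \<subseteq> \<Union>{U, - C}"
      using U C by (auto simp: open_Compl)
    obtain \<B> where \<B>: "\<forall>B\<in>\<B>. \<exists>x r. 0 < r \<and> B = ball x r" "msupport \<mu> \<subseteq> \<Union>\<B>"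
        "\<forall>B\<in>\<B>. \<exists>W\<in>{U, - C}. B \<subseteq> W"
      and order: "\<forall>K\<subseteq>\<B>. finite K \<and> card K > n + 1 \<longrightarrow> \<Inter>K = {}"
      using mp[OF spec[OF dim[unfolded ball_covering_dim_le_def], of "{U, - C}"] cover]
      by (elim exE conjE) (rule that)
    have balls_\<B>: "\<B> \<subseteq> open_balls"
    proof
      fix B assume "B \<in> \<B>"
      then obtain x r where "0 < r" "B = ball x r"
        using \<B>(1) by blast
      then show "B \<in> open_balls"
        unfolding open_balls_def by blast
    qed
    then have open_\<B>: "open B" if "B \<in> \<B>" for B
      using that by (auto simp: open_balls_def)
    obtain V where V: "V \<subseteq> {B \<in> \<B>. B \<subseteq> U}" "countable V" "\<Union>V = \<Union>{B \<in> \<B>. B \<subseteq> U}"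
      using Lindelof[of "{B \<in> \<B>. B \<subseteq> U}"] open_\<B> by auto
    have V_sets: "V \<subseteq> sets \<mu>"
    proof
      fix B assume "B \<in> V"
      then have "open B"
        using V(1) open_\<B> by blast
      then show "B \<in> sets \<mu>"
        using sets(1) by simp
    qed
    have V_eq: "emeasure \<mu> (\<Union>V) = emeasure \<nu> (\<Union>V)"
    proof (rule emeasure_countable_Union_eqI[OF V(2) V_sets])
      fix K assume K: "finite K" "K \<subseteq> V"
      show "emeasure \<mu> (\<Union>K) = emeasure \<nu> (\<Union>K)"
      proof (rule emeasure_Union_eq_of_small_unions[where N = "n + 1"])
        show "emeasure \<mu> (\<Union>B) = emeasure \<nu> (\<Union>B)" if B: "B \<subseteq> K" "card B \<le> n + 1" for B
        proof (rule balls)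
          show "B \<subseteq> open_balls"
            using B(1) K(2) V(1) balls_\<B> by blast
          show "finite B"
            using B(1) K(1) by (rule finite_subset)
        qed (rule B(2))
        show "\<Inter>B = {}" if B: "B \<subseteq> K" "n + 1 < card B" for B
        proof -
          have "B \<subseteq> \<B>" "finite B"
            using B(1) K V(1) finite_subset[OF B(1) K(1)] by blast+
          then show ?thesis
            using order B(2) by blast
        qed
        show "K \<subseteq> sets \<mu>"
          using K(2) V_sets by (rule order_trans)
      qed (simp_all only: sets K(1) \<mu>.finite_measure_axioms \<nu>.finite_measure_axioms)
    qed (simp only: sets)
    have sub: "C \<subseteq> \<Union>V \<union> - msupport \<mu>"
    proof
      fix x assume "x \<in> C"
      show "x \<in> \<Union>V \<union> - msupport \<mu>"
      proof (cases "x \<in> msupport \<mu>")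
        case True
        then obtain B where "B \<in> \<B>" "x \<in> B"
          using \<B>(2) by auto
        moreover from this have "B \<subseteq> U"
          using \<B>(3) \<open>x \<in> C\<close> by auto
        ultimately show ?thesis
          unfolding V(3) by blast
      qed simp
    qed
    have V_sets': "\<Union>V \<in> sets \<mu>"
      using V(2) V_sets by (intro sets.countable_Union)
    have "emeasure \<mu> C \<le> emeasure \<mu> (\<Union>V \<union> - msupport \<mu>)"
      using sub V_sets' emeasure_Compl_msupport[OF sets(1)] by (intro emeasure_mono sets.Un) (simp_all add: null_setsD2)
    also have "\<dots> = emeasure \<nu> (\<Union>V)"
      using V_eq emeasure_Un_null_set[OF V_sets' emeasure_Compl_msupport[OF sets(1)]] by simp
    also have "\<dots> \<le> emeasure \<nu> U"
    proof (rule emeasure_mono)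
      show "\<Union>V \<subseteq> U"
        using V(1) by blast
    qed (simp add: sets U)
    finally show ?thesis .
  qed
  have "emeasure \<mu> U = (SUP C\<in>{C. C \<subseteq> U \<and> compact C}. emeasure \<mu> C)"
    using U sets by (intro inner_regular) auto
  also have "\<dots> \<le> emeasure \<nu> U"
    using closed_le by (intro SUP_least) (auto simp: compact_imp_closed)
  finally show ?thesis .
qed

lemma ball_covering_dim_leE:
  assumes "metric_covering_dim S \<le> enat k"
  obtains n where "n \<le> k" "ball_covering_dim_le S n"
proof -
  have ne: "enat ` {n. ball_covering_dim_le S n} \<noteq> {}"
  proof
    assume "enat ` {n. ball_covering_dim_le S n} = {}"
    then have "metric_covering_dim S = \<infinity>"
      unfolding metric_covering_dim_def by (simp add: Inf_enat_def)
    with assms show False by simp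
  qed
  have "metric_covering_dim S \<in> enat ` {n. ball_covering_dim_le S n}"
    unfolding metric_covering_dim_def using ne by (metis ex_in_conv wellorder_InfI)
  then obtain n where n: "metric_covering_dim S = enat n" "ball_covering_dim_le S n"
    by blast
  have "n \<le> k"
    using assms unfolding n(1) by simp
  then show thesis
    using n(2) by (rule that)
qed

text \<open>For finite \<open>n\<close> the two inequalities on open sets come from the dimensions of the two supports.
  For infinite \<open>n\<close> the measures agree on all finite unions of balls, hence on the countable
  unions of balls, which are the open sets.\<close>

lemma min_dist_separates_Omega:
  fixes \<mu> \<nu> :: "'a::polish_space measure"
  assumes \<mu>: "\<mu> \<in> Omega n" and \<nu>: "\<nu> \<in> Omega n"
    and eq: "\<And>f. f \<in> min_dist n \<Longrightarrow> distr \<mu> borel f = distr \<nu> borel f"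
  shows "\<mu> = \<nu>"
proof (cases n)
  case (enat k)
  have probs: "\<mu> \<in> borel_probs" "\<nu> \<in> borel_probs"
    using \<mu> \<nu> enat by (auto simp: Omega_def)
  have balls: "emeasure \<mu> (\<Union>K) = emeasure \<nu> (\<Union>K)"
    if "K \<subseteq> open_balls" "finite K" "card K \<le> k + 1" for K
    using that eq enat by (intro emeasure_Union_balls_eq[OF probs, of k]) (auto simp: min_dist_def)
  obtain i where i: "i \<le> k" "ball_covering_dim_le (msupport \<mu>) i"
    using \<mu> enat by (auto simp: Omega_def elim: ball_covering_dim_leE)
  obtain j where j: "j \<le> k" "ball_covering_dim_le (msupport \<nu>) j"
    using \<nu> enat by (auto simp: Omega_def elim: ball_covering_dim_leE)
  show ?thesis
  proof (rule borel_probs_eqI_open[OF probs])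
    fix U :: "'a set" assume U: "open U"
    show "emeasure \<mu> U = emeasure \<nu> U"
    proof (rule antisym)
      show "emeasure \<mu> U \<le> emeasure \<nu> U"
        using i(1) by (intro emeasure_open_le_of_small_ball_unions[OF probs i(2) _ U] balls) auto
      show "emeasure \<nu> U \<le> emeasure \<mu> U"
        using j(1) by (intro emeasure_open_le_of_small_ball_unions[OF probs(2,1) j(2) _ U] balls[symmetric]) auto
    qed
  qed
next
  case infinity
  have probs: "\<mu> \<in> borel_probs" "\<nu> \<in> borel_probs"
    using \<mu> \<nu> infinity by (auto simp: Omega_def)
  have eq': "distr \<mu> borel f = distr \<nu> borel f" if "f \<in> min_dist_fin k" for f k
    using that infinity by (intro eq) (auto simp: min_dist_def)
  show ?thesis
  proof (rule borel_probs_eqI_open[OF probs])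
    fix U :: "'a set" assume U: "open U"
    define \<B> where "\<B> = {B \<in> open_balls. B \<subseteq> U}"
    have "U = \<Union>\<B>"
    proof
      show "U \<subseteq> \<Union>\<B>"
      proof
        fix x assume "x \<in> U"
        then obtain r where "0 < r" "ball x r \<subseteq> U"
          using U by (meson open_contains_ball)
        then show "x \<in> \<Union>\<B>"
          by (intro UnionI[of "ball x r"]) (auto simp: \<B>_def open_balls_def)
      qed
    qed (auto simp: \<B>_def)
    moreover obtain V where V: "V \<subseteq> \<B>" "countable V" "\<Union>V = \<Union>\<B>"
      using Lindelof[of \<B>] by (auto simp: \<B>_def open_balls_def)
    moreover have "emeasure \<mu> (\<Union>V) = emeasure \<nu> (\<Union>V)"
    proof (rule emeasure_countable_Union_eqI[OF V(2)])
      show "V \<subseteq> sets \<mu>" "sets \<nu> = sets \<mu>"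
        using V(1) borel_probsD(2)[OF probs(1)] borel_probsD(2)[OF probs(2)]
        by (auto simp: \<B>_def open_balls_def)
      show "emeasure \<mu> (\<Union>K) = emeasure \<nu> (\<Union>K)" if "finite K" "K \<subseteq> V" for K
        using that V(1) by (intro emeasure_Union_balls_eq[OF probs eq', of "card K"]) (auto simp: \<B>_def)
    qed
    ultimately show "emeasure \<mu> U = emeasure \<nu> U"
      by simp
  qed
qed

theorem proposition14:
  fixes p :: real
  assumes "1 \<le> p"
  shows "real_metric_on (wass_space p :: 'a::polish_space measure set) (theta p) \<and>
         (\<forall>n::enat. real_metric_on (Omega_p p n :: 'a measure set) (theta_n p n)) \<and>
         (\<forall>m n :: enat. m \<le> n \<longrightarrow>
           (\<forall>\<mu>\<in>(wass_space p :: 'a measure set). \<forall>\<nu>\<in>wass_space p.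
              theta_n p m \<mu> \<nu> \<le> theta_n p n \<mu> \<nu> \<and>
              theta_n p n \<mu> \<nu> \<le> theta p \<mu> \<nu> \<and>
              theta p \<mu> \<nu> \<le> wass_dist p \<mu> \<nu>))"
proof (intro conjI allI impI ballI)
  show "real_metric_on (wass_space p :: 'a measure set) (theta p)"
    unfolding theta_def[abs_def]
  proof (rule real_metric_on_SUP_wass_dist[OF assms order_refl order_refl])
    fix \<mu> \<nu> :: "'a measure"
    assume W: "\<mu> \<in> wass_space p" "\<nu> \<in> wass_space p"
      and eq: "\<And>f. f \<in> Lip1 \<Longrightarrow> distr \<mu> borel f = distr \<nu> borel f"
    have "\<mu> \<in> Omega \<infinity>" "\<nu> \<in> Omega \<infinity>"
      using W by (simp_all add: Omega_def wass_space_def)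
    then show "\<mu> = \<nu>"
      using eq[OF subsetD[OF min_dist_subset_Lip1]] by (rule min_dist_separates_Omega)
  qed
  show "real_metric_on (Omega_p p n :: 'a measure set) (theta_n p n)" for n
    unfolding theta_n_def[abs_def]
  proof (rule real_metric_on_SUP_wass_dist[OF assms min_dist_subset_Lip1])
    show "Omega_p p n \<subseteq> (wass_space p :: 'a measure set)"
      by (simp add: Omega_p_def)
    fix \<mu> \<nu> :: "'a measure"
    assume "\<mu> \<in> Omega_p p n" "\<nu> \<in> Omega_p p n"
      and eq: "\<And>f. f \<in> min_dist n \<Longrightarrow> distr \<mu> borel f = distr \<nu> borel f"
    then have "\<mu> \<in> Omega n" "\<nu> \<in> Omega n"
      by (simp_all add: Omega_p_def)
    then show "\<mu> = \<nu>"
      using eq by (rule min_dist_separates_Omega)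
  qed
next
  fix m n :: enat and \<mu> \<nu> :: "'a measure" assume "m \<le> n"
  then show "theta_n p m \<mu> \<nu> \<le> theta_n p n \<mu> \<nu>"
    unfolding theta_n_def by (intro SUP_subset_mono min_dist_mono) auto
  show "theta_n p n \<mu> \<nu> \<le> theta p \<mu> \<nu>"
    unfolding theta_n_def theta_def by (intro SUP_subset_mono min_dist_subset_Lip1) auto
  show "theta p \<mu> \<nu> \<le> wass_dist p \<mu> \<nu>"
    unfolding theta_def using assms by (intro SUP_wass_dist_lipschitz_le) simp_all
qed

end
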